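(* Let $B$ be a Banach space, let $S$ be a nonempty closed convex subset of $B$, and let $T:S\to S$ satisfy, for some $\delta\in(0,1)$, $\|Tx-Ty\|\le\delta\|x-y\|$ for all $x,y\in S$. Let $\varepsilon>0$ be a fixed number and let $\widetilde T:S\to S$ be an approximate operator of $T$, i.e. $\|Tx-\widetilde Tx\|\le\varepsilon$ for all $x\in S$. Let $\{\alpha_n^1\}_{n=0}^\infty,\{\alpha_n^2\}_{n=0}^\infty,\{\alpha_n^3\}_{n=0}^\infty$ be real sequences in $[0,1]$ satisfying (i) $\frac12\le\alpha_n^1$ for all $n\in\mathbb{N}$, and (ii) $\sum_{n=0}^\infty\alpha_n^1=\infty$. Let $p_0,\widetilde p_0\in S$ and let $\{p_n\}_{n=0}^\infty$ and $\{\widetilde p_n\}_{n=0}^\infty$ be defined, for $n\in\mathbb{N}$, by $$\begin{aligned} r_n&=(1-\alpha_n^3)p_n+\alpha_n^3Tp_n,\\ q_n&=(1-\alpha_n^2)Tp_n+\alpha_n^2Tr_n,\\ p_{n+1}&=(1-\alpha_n^1)Tp_n+\alpha_n^1Tq_n, \end{aligned}$$ and $$\begin{aligned} \widetilde r_n&=(1-\alpha_n^3)\widetilde p_n+\alpha_n^3\widetilde T\widetilde p_n,\\ \widetilde q_n&=(1-\alpha_n^2)\widetilde T\widetilde p_n+\alpha_n^2\widetilde T\widetilde r_n,\\ \widetilde p_{n+1}&=(1-\alpha_n^1)\widetilde T\widetilde p_n+\alpha_n^1\widetilde T\widetilde q_n. \end{aligned}$$ If $p,\widetilde p\in S$ satisfy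 $Tp=p$ and $\widetilde T\widetilde p=\widetilde p$, and $\widetilde p_n\to\widetilde p$ as $n\to\infty$, then $$\|p-\widetilde p\|\le\frac{5\varepsilon}{1-\delta}.$$
   Context: $\mathbb{N}$ denotes the set of nonnegative integers (including zero). In the superscripted symbols $\alpha_n^i$ the superscript $i\in\{1,2,3\}$ is an index, not a power. Convergence is in the norm of $B$. *)

theory Defs
  imports "HOL-Analysis.Analysis"
begin

end

theory Submission
  imports Defs
begin

text \<open>The two fixed points can be compared directly. Since \<open>x = T x\<close> and
  \<open>x' = T' x'\<close>, their distance splits at \<open>T x'\<close> into a contraction part,
  at most \<delta> times that same distance, and an approximation error, at most \<epsilon>. Solving
  this self-referential inequality gives \<epsilon>/(1 - \<delta>), which lies below the claimed
  bound. \<open>fixed_point_perturbation\<close> carries the argument; it asks for the two estimates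
  only at the points concerned, so no domain \<open>S\<close> appears in it.\<close>

lemma fixed_point_perturbation:
  fixes T T' :: "'a::real_normed_vector \<Rightarrow> 'a"
  assumes "\<delta> < 1"
    and lip: "norm (T x - T x') \<le> \<delta> * norm (x - x')"
    and approx: "norm (T x' - T' x') \<le> \<epsilon>"
    and "T x = x" and "T' x' = x'"
  shows "norm (x - x') \<le> \<epsilon> / (1 - \<delta>)"
proof -
  \<comment> \<open>The intermediate point is \<open>T x'\<close>, not \<open>T' x\<close>: the
    contraction estimate is available for \<open>T\<close>, so both points must first be compared
    under \<open>T\<close>.\<close>
  have "norm (x - x') = norm ((T x - T x') + (T x' - T' x'))"
    using assms by simp
  also have "\<dots> \<le> \<delta> * norm (x - x') + \<epsilon>"
    using norm_triangle_mono[OF lip approx] .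
  finally show ?thesis
    \<comment> \<open>The term \<open>\<delta> * norm (x - x')\<close> is absorbed on the left; its
      coefficient 1 - \<delta> is positive, so division keeps the inequality.\<close>
    using \<open>\<delta> < 1\<close> by (simp add: pos_le_divide_eq algebra_simps)
qed

theorem theorem4:
  fixes S :: "'a::banach set"
    and T T' :: "'a \<Rightarrow> 'a"
    and \<delta> \<epsilon> :: real
    and \<alpha>1 \<alpha>2 \<alpha>3 :: "nat \<Rightarrow> real"
    and p q r p' q' r' :: "nat \<Rightarrow> 'a"
    and x x' :: 'a
  assumes "S \<noteq> {}" and "closed S" and "convex S"
    and "T \<in> S \<rightarrow> S"
    and "0 < \<delta>" and "\<delta> < 1"
    and "\<And>u v. u \<in> S \<Longrightarrow> v \<in> S \<Longrightarrow> norm (T u - T v) \<le> \<delta> * norm (u - v)"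
    and "\<epsilon> > 0"
    and "T' \<in> S \<rightarrow> S"
    and "\<And>u. u \<in> S \<Longrightarrow> norm (T u - T' u) \<le> \<epsilon>"
    and "\<And>n. \<alpha>1 n \<in> {0..1}" and "\<And>n. \<alpha>2 n \<in> {0..1}" and "\<And>n. \<alpha>3 n \<in> {0..1}"
    and "\<And>n. 1 / 2 \<le> \<alpha>1 n"
    and "filterlim (\<lambda>n. \<Sum>k\<le>n. \<alpha>1 k) at_top sequentially"
    and "p 0 \<in> S" and "p' 0 \<in> S"
    and "\<And>n. r n = (1 - \<alpha>3 n) *\<^sub>R p n + \<alpha>3 n *\<^sub>R T (p n)"
    and "\<And>n. q n = (1 - \<alpha>2 n) *\<^sub>R T (p n) + \<alpha>2 n *\<^sub>R T (r n)"
    and "\<And>n. p (Suc n) = (1 - \<alpha>1 n) *\<^sub>R T (p n) + \<alpha>1 n *\<^sub>R T (q n)"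
    and "\<And>n. r' n = (1 - \<alpha>3 n) *\<^sub>R p' n + \<alpha>3 n *\<^sub>R T' (p' n)"
    and "\<And>n. q' n = (1 - \<alpha>2 n) *\<^sub>R T' (p' n) + \<alpha>2 n *\<^sub>R T' (r' n)"
    and "\<And>n. p' (Suc n) = (1 - \<alpha>1 n) *\<^sub>R T' (p' n) + \<alpha>1 n *\<^sub>R T' (q' n)"
    and "x \<in> S" and "T x = x"
    and "x' \<in> S" and "T' x' = x'"
    and "p' \<longlonglongrightarrow> x'"
  shows "norm (x - x') \<le> 5 * \<epsilon> / (1 - \<delta>)"
proof -
  have "norm (x - x') \<le> \<epsilon> / (1 - \<delta>)"
    \<comment> \<open>Membership of \<open>x\<close> and \<open>x'\<close> in \<open>S\<close> makes
      the Lipschitz bound available at this pair and the approximation bound at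
      \<open>x'\<close>.\<close>
    using assms by (intro fixed_point_perturbation[of \<delta> T x x' T' \<epsilon>]) blast+
  also have "\<dots> \<le> 5 * \<epsilon> / (1 - \<delta>)"
    using \<open>\<epsilon> > 0\<close> \<open>\<delta> < 1\<close> by (intro divide_right_mono) simp_all
  finally show ?thesis .
qed

end
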